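(* For all positive integers $d\le n$, \begin{equation*} T(2n,d)=\frac{(-1)^{n-d}\pi^{2n}}{4^n(2n)!}\sum_{\ell =0}^{n-d} \binom{n-\ell}{d}\binom{2n}{2\ell}E_{2\ell} . \end{equation*}
   Context: For positive integers $s_1,\dots,s_d$ (with $s_1\ge2$), the multiple $t$-value is $t(s_1,\dots,s_d)=\sum_{n_1>\cdots>n_d\ge 1}\prod_{i=1}^d (2n_i-1)^{-s_i}$. For $d\le n$ define $T(2n,d)=\sum_{j_1+\cdots+j_d=n,\ j_1,\dots,j_d\ge 1} t(2j_1,\dots,2j_d)$. The Euler numbers $E_{2j}$ are defined by $\sec x=\sum_{j\ge0}(-1)^jE_{2j}\frac{x^{2j}}{(2j)!}$ (so $E_0=1$, $E_2=-1$, $E_4=5,\dots$), and $E_{2j+1}=0$. *)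

theory Defs
  imports "HOL-Analysis.Analysis"
begin

(* t(s_1,...,s_d).  Lists are 0-based, so s_i is s ! (i - 1).  All terms are positive, so the
   unordered infinite sum is the usual iterated sum whenever that converges. *)
definition mtv :: "nat list \<Rightarrow> real" where
  "mtv s = (\<Sum>\<^sub>\<infinity>ns \<in> {ns. length ns = length s \<and> sorted_wrt (>) ns \<and> (\<forall>m\<in>set ns. m \<ge> 1)}.
              \<Prod>i<length s. 1 / (2 * real (ns ! i) - 1) ^ (s ! i))"

(* T(w,d), where w = 2n is the weight; it is only meaningful for even w. *)
definition mtv_sum :: "nat \<Rightarrow> nat \<Rightarrow> real" where
  "mtv_sum w d = (\<Sum>js | length js = d \<and> 2 * sum_list js = w \<and> (\<forall>j\<in>set js. j \<ge> 1).
                    mtv (map (\<lambda>j. 2 * j) js))"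

lemma finite_mtv_sum_index:
  "finite {js :: nat list. length js = d \<and> 2 * sum_list js = w \<and> (\<forall>j\<in>set js. j \<ge> 1)}"
proof (rule finite_subset)
  show "{js :: nat list. length js = d \<and> 2 * sum_list js = w \<and> (\<forall>j\<in>set js. j \<ge> 1)}
      \<subseteq> {js. set js \<subseteq> {..w} \<and> length js = d}"
    using member_le_sum_list by fastforce
qed (simp add: finite_lists_length_eq)

(* The coefficients are read off from the Taylor series of sec = 1 / cos. *)
definition euler_number :: "nat \<Rightarrow> real" where
  "euler_number n =
     (if even n then (-1) ^ (n div 2) * fact n * fps_nth (inverse (fps_cos 1)) n else 0)"

lemma fps_sec_nth_odd:
  assumes "odd n"
  shows   "fps_nth (inverse (fps_cos (1::real))) n = 0"
proof -
  define F where "F = inverse (fps_cos (1::real))"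
  have cosF: "fps_cos (1::real) * F = 1"
    unfolding F_def by (rule inverse_mult_eq_1') simp
  have "fps_nth F n = 0"
    using assms
  proof (induction n rule: less_induct)
    case (less n)
    have "0 = fps_nth (fps_cos 1 * F) n"
      using less.prems by (auto simp: cosF elim: oddE)
    also have "\<dots> = (\<Sum>i=0..n. fps_nth (fps_cos 1) i * fps_nth F (n - i))"
      by (simp add: fps_mult_nth)
    also have "\<dots> = (\<Sum>i\<in>{0}. fps_nth (fps_cos 1) i * fps_nth F (n - i))"
    proof (rule sum.mono_neutral_right)
      show "\<forall>i\<in>{0..n} - {0}. fps_nth (fps_cos 1) i * fps_nth F (n - i) = 0"
      proof
        fix i assume i: "i \<in> {0..n} - {0}"
        show "fps_nth (fps_cos 1) i * fps_nth F (n - i) = 0"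
        proof (cases "even i")
          case True
          with i less show ?thesis by (intro mult_eq_0_iff[THEN iffD2] disjI2 less.IH) auto
        qed (simp add: fps_cos_def)
      qed
    qed auto
    finally show ?case by (simp add: fps_cos_def)
  qed
  thus ?thesis by (simp add: F_def)
qed

lemma sec_has_fps_expansion:
  "(\<lambda>x::real. 1 / cos x) has_fps_expansion
     Abs_fps (\<lambda>n. if even n then (-1) ^ (n div 2) * euler_number n / fact n else 0)"
proof -
  have "(\<lambda>x::real. inverse (cos (1 * x))) has_fps_expansion inverse (fps_cos 1)"
    by (intro has_fps_expansion_inverse has_fps_expansion_cos) simp
  moreover have "inverse (fps_cos (1::real)) =
      Abs_fps (\<lambda>n. if even n then (-1) ^ (n div 2) * euler_number n / fact n else 0)"
    by (rule fps_ext)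
       (simp add: euler_number_def fps_sec_nth_odd flip: power_mult_distrib mult.assoc)
  ultimately show ?thesis by (simp add: field_simps)
qed

lemma euler_number_0: "euler_number 0 = 1"
  by (simp add: euler_number_def)

end

theory Submission
  imports Defs
begin

text \<open>
  With $c_k = (2k-1)^{-2}$, the generating function of the values $T(2n,d)$ is
  \[ \sum_{n,d} T(2n,d)\, y^d z^n = \prod_k \Bigl(1 + y\,\frac{c_k z}{1 - c_k z}\Bigr)
      = \frac{\prod_k (1 + (y-1) c_k z)}{\prod_k (1 - c_k z)}. \]
  The elementary symmetric functions $e_m$ of the $c_k$ are read off from
  $\cos(\pi x/2) = \prod_k (1 - c_k x^2)$, so that $e_m = (\pi/2)^{2m}/(2m)!$ and the denominator
  is $\cos(\pi\sqrt z/2)$. Comparing coefficients of $y^d z^n$ gives the formula.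
  The algebra is done for the finite products over $k \le N$; all coefficients converge as
  $N \to \infty$, and this convergence also bounds the truncated sums, hence yields the
  summability of the multiple $t$-values.
\<close>

section \<open>Truncated sums over strictly decreasing index lists\<close>

definition decr_lists :: "nat \<Rightarrow> nat \<Rightarrow> nat list set" where
  "decr_lists N l = {ns. length ns = l \<and> sorted_wrt (>) ns \<and> set ns \<subseteq> {1..N}}"

lemma finite_decr_lists [simp]: "finite (decr_lists N l)"
  by (rule finite_subset[OF _ finite_lists_length_eq[of "{1..N}" l]]) (auto simp: decr_lists_def)

lemma decr_lists_0_right [simp]: "decr_lists N 0 = {[]}"
  by (auto simp: decr_lists_def)

lemma decr_lists_0_Suc [simp]: "decr_lists 0 (Suc l) = {}"
  by (auto simp: decr_lists_def length_Suc_conv)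

text \<open>The head is the largest entry: either it equals \<open>Suc N\<close> and the tail is
  bounded by \<open>N\<close>, or the whole list is bounded by \<open>N\<close>.\<close>

lemma decr_lists_Suc_Suc:
  "decr_lists (Suc N) (Suc l) = decr_lists N (Suc l) \<union> (#) (Suc N) ` decr_lists N l"
proof (intro equalityI subsetI)
  fix ns assume "ns \<in> decr_lists (Suc N) (Suc l)"
  then obtain m ms where ns: "ns = m # ms" "length ms = l" "sorted_wrt (>) ms"
      "\<forall>x\<in>set ms. x < m" "m \<le> Suc N" "1 \<le> m" "set ms \<subseteq> {1..Suc N}"
    by (auto simp: decr_lists_def length_Suc_conv)
  show "ns \<in> decr_lists N (Suc l) \<union> (#) (Suc N) ` decr_lists N l"
  proof (cases "m = Suc N")
    case True
    with ns show ?thesis by (force simp: decr_lists_def)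
  next
    case False
    with ns show ?thesis by (force simp: decr_lists_def)
  qed
qed (force simp: decr_lists_def)

text \<open>The monomial quasisymmetric polynomial in \<open>c 1\<close>, ..., \<open>c N\<close>.
  With \<open>c k = 1 / (2 * k - 1)^2\<close> the exponents \<open>js\<close> belong to the
  truncated t-value with arguments \<open>2 * j\<close>.\<close>

definition trunc_mtv :: "(nat \<Rightarrow> 'a :: comm_semiring_1) \<Rightarrow> nat \<Rightarrow> nat list \<Rightarrow> 'a" where
  "trunc_mtv c N js = (\<Sum>ns\<in>decr_lists N (length js). \<Prod>i<length js. c (ns ! i) ^ (js ! i))"

lemma trunc_mtv_Nil [simp]: "trunc_mtv c N [] = 1"
  by (simp add: trunc_mtv_def)

lemma trunc_mtv_0_Cons [simp]: "trunc_mtv c 0 (j # js) = 0"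
  by (simp add: trunc_mtv_def)

lemma trunc_mtv_Suc_Cons:
  "trunc_mtv c (Suc N) (j # js) = trunc_mtv c N (j # js) + c (Suc N) ^ j * trunc_mtv c N js"
proof -
  have disj: "decr_lists N (Suc l) \<inter> (#) (Suc N) ` decr_lists N l = {}" for l
    by (auto simp: decr_lists_def)
  show ?thesis
    unfolding trunc_mtv_def list.size add_0_right add_Suc_right decr_lists_Suc_Suc
    by (subst sum.union_disjoint)
       (simp_all add: disj sum.reindex prod.lessThan_Suc_shift sum_distrib_left del: prod.lessThan_Suc)
qed

section \<open>Compositions and the generating function for fixed depth\<close>

definition compositions :: "nat \<Rightarrow> nat \<Rightarrow> nat list set" where
  "compositions d n = {js. length js = d \<and> sum_list js = n \<and> (\<forall>j\<in>set js. j \<ge> 1)}"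

lemma finite_compositions [simp]: "finite (compositions d n)"
  using finite_mtv_sum_index[of d "2 * n"] by (simp add: compositions_def)

lemma compositions_0: "compositions 0 n = (if n = 0 then {[]} else {})"
  by (auto simp: compositions_def)

lemma compositions_Suc:
  "compositions (Suc d) n = (\<Union>j\<in>{1..n}. (#) j ` compositions d (n - j))"
  by (force simp: compositions_def length_Suc_conv)

lemma sum_compositions_Suc:
  "(\<Sum>js\<in>compositions (Suc d) n. f js) =
     (\<Sum>j=1..n. \<Sum>js\<in>compositions d (n - j). f (j # js))"
  unfolding compositions_Suc by (subst sum.UNION_disjoint) (auto simp: sum.reindex)

text \<open>
  The coefficient of $y^d$ in $\prod_{k\le N} (1 + y c_k z/(1 - c_k z))$; the factors $1 - c_k z$ are
  cleared in the lemmas below to avoid power series inverses.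
\<close>
definition trunc_fps :: "(nat \<Rightarrow> 'a :: comm_ring_1) \<Rightarrow> nat \<Rightarrow> nat \<Rightarrow> 'a fps" where
  "trunc_fps c N d = Abs_fps (\<lambda>n. \<Sum>js\<in>compositions d n. trunc_mtv c N js)"

lemma trunc_fps_0_right [simp]: "trunc_fps c N 0 = 1"
  by (rule fps_ext) (simp add: trunc_fps_def compositions_0)

lemma trunc_fps_0_Suc [simp]: "trunc_fps c 0 (Suc d) = 0"
  by (rule fps_ext) (simp add: trunc_fps_def sum_compositions_Suc)

text \<open>Raising the cutoff multiplies the product over k by the factor 1 + y a z/(1 - a z),
  where \<open>a = c (Suc N)\<close>; this is the coefficient of y^(d+1), times 1 - a z.\<close>

lemma trunc_fps_Suc_Suc:
  "(1 - fps_const (c (Suc N)) * fps_X) * trunc_fps c (Suc N) (Suc d) =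
     (1 - fps_const (c (Suc N)) * fps_X) * trunc_fps c N (Suc d) +
     fps_const (c (Suc N)) * fps_X * trunc_fps c N d"
proof -
  define a where "a = c (Suc N)"
  \<comment> \<open>The geometric series a z/(1 - a z). Its zero constant term reflects that the
    parts of a composition are at least 1.\<close>
  define G where "G = Abs_fps (\<lambda>n. if n = 0 then 0 else a ^ n)"
  have "trunc_fps c (Suc N) (Suc d) = trunc_fps c N (Suc d) + G * trunc_fps c N d"
  proof (rule fps_ext)
    fix n
    have "fps_nth (G * trunc_fps c N d) n =
            (\<Sum>j=1..n. a ^ j * (\<Sum>js\<in>compositions d (n - j). trunc_mtv c N js))"
      by (simp add: fps_mult_nth G_def trunc_fps_def sum.atLeast_Suc_atMost)
    thus "fps_nth (trunc_fps c (Suc N) (Suc d)) n =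
            fps_nth (trunc_fps c N (Suc d) + G * trunc_fps c N d) n"
      by (simp add: trunc_fps_def sum_compositions_Suc trunc_mtv_Suc_Cons sum.distrib
            sum_distrib_left a_def)
  qed
  moreover have "(1 - fps_const a * fps_X) * G = fps_const a * fps_X"
  proof (rule fps_ext)
    fix n
    show "fps_nth ((1 - fps_const a * fps_X) * G) n = fps_nth (fps_const a * fps_X) n"
      by (cases n) (auto simp: G_def left_diff_distrib mult.assoc fps_X_nth)
  qed
  ultimately show ?thesis
    by (simp add: a_def [symmetric] distrib_left mult.assoc [symmetric])
qed

section \<open>Elementary symmetric polynomials and the quotient form of the generating
  function\<close>

primrec elem_sym :: "(nat \<Rightarrow> 'a :: comm_semiring_1) \<Rightarrow> nat \<Rightarrow> nat \<Rightarrow> 'a" where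
  "elem_sym c 0 m = (if m = 0 then 1 else 0)"
| "elem_sym c (Suc N) m =
     elem_sym c N m + (case m of 0 \<Rightarrow> 0 | Suc k \<Rightarrow> c (Suc N) * elem_sym c N k)"

lemma elem_sym_0_right [simp]: "elem_sym c N 0 = 1"
  by (induction N) auto

text \<open>The finite product is written as an infinite series so that Tannery's theorem can be
  applied to it as \<open>N\<close> grows.\<close>

lemma sums_elem_sym:
  fixes c :: "nat \<Rightarrow> real"
  shows "(\<lambda>m. elem_sym c N m * w ^ m) sums (\<Prod>k=1..N. 1 + c k * w)"
proof (induction N)
  case 0
  show ?case using sums_single[of 0 "\<lambda>m. w ^ m"] by (simp add: if_distrib[of "\<lambda>t. t * _"] cong: if_cong)
next
  case (Suc N)
  define g where "g m = (case m of 0 \<Rightarrow> 0 | Suc k \<Rightarrow> c (Suc N) * elem_sym c N k) * w ^ m" for m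
  have "(\<lambda>m. g (Suc m)) sums (c (Suc N) * w * (\<Prod>k=1..N. 1 + c k * w))"
    using sums_mult[OF Suc, of "c (Suc N) * w"] by (simp add: g_def mult_ac)
  hence "g sums (c (Suc N) * w * (\<Prod>k=1..N. 1 + c k * w))"
    by (subst (asm) sums_Suc_iff) (simp add: g_def)
  from sums_add[OF Suc this] show ?case
    by (simp add: g_def algebra_simps)
qed

lemma elem_sym_nonneg:
  fixes c :: "nat \<Rightarrow> real"
  assumes "\<And>k. c k \<ge> 0"
  shows "elem_sym c N m \<ge> 0"
  by (induction N arbitrary: m) (auto simp: assms split: nat.splits)

text \<open>Every product of \<open>m\<close> distinct variables occurs in the expansion of the m-th
  power of their sum. This yields bounds uniform in \<open>N\<close>.\<close>

lemma elem_sym_le_power: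
  fixes c :: "nat \<Rightarrow> real"
  assumes "\<And>k. c k \<ge> 0"
  shows "elem_sym c N m \<le> (\<Sum>k=1..N. c k) ^ m"
proof (induction N arbitrary: m)
  case 0
  thus ?case by simp
next
  case (Suc N)
  define s where "s = (\<Sum>k=1..N. c k)"
  have s: "s \<ge> 0" unfolding s_def by (intro sum_nonneg assms)
  show ?case
  proof (cases m)
    case (Suc k)
    have "elem_sym c (Suc N) m \<le> s ^ Suc k + c (Suc N) * s ^ k"
      using Suc.IH[of "Suc k"] Suc.IH[of k] assms[of "Suc N"]
      by (auto simp: Suc s_def intro!: add_mono mult_left_mono)
    also have "\<dots> = (s + c (Suc N)) * s ^ k"
      by (simp add: algebra_simps)
    also have "\<dots> \<le> (s + c (Suc N)) * (s + c (Suc N)) ^ k"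
      using s assms[of "Suc N"] by (intro mult_left_mono power_mono) auto
    finally show ?thesis by (simp add: Suc s_def)
  qed auto
qed

text \<open>
  The coefficient of $y^d$ in $\sum_m e_m (y-1)^m z^m$; the case $d = 0$ is the denominator of the
  generating function.
\<close>
definition depth_fps :: "(nat \<Rightarrow> 'a :: comm_ring_1) \<Rightarrow> nat \<Rightarrow> 'a fps" where
  "depth_fps e d = Abs_fps (\<lambda>m. (-1) ^ (m + d) * of_nat (m choose d) * e m)"

lemma depth_fps_elem_sym_0_Suc: "depth_fps (elem_sym c 0) (Suc d) = 0"
  by (rule fps_ext) (simp add: depth_fps_def)

lemma depth_fps_elem_sym_Suc_0:
  "depth_fps (elem_sym c (Suc N)) 0 =
     (1 - fps_const (c (Suc N)) * fps_X) * depth_fps (elem_sym c N) 0"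
proof (rule fps_ext)
  fix n
  show "fps_nth (depth_fps (elem_sym c (Suc N)) 0) n =
    fps_nth ((1 - fps_const (c (Suc N)) * fps_X) * depth_fps (elem_sym c N) 0) n"
    by (cases n) (auto simp: depth_fps_def left_diff_distrib mult.assoc algebra_simps)
qed

text \<open>The product of the 1 + (y-1) c_k z gains the factor (1 - a z) + y a z; on coefficients
  this is Pascal's rule.\<close>

lemma depth_fps_elem_sym_Suc_Suc:
  "depth_fps (elem_sym c (Suc N)) (Suc d) =
     (1 - fps_const (c (Suc N)) * fps_X) * depth_fps (elem_sym c N) (Suc d) +
     fps_const (c (Suc N)) * fps_X * depth_fps (elem_sym c N) d"
proof (rule fps_ext)
  fix n
  show "fps_nth (depth_fps (elem_sym c (Suc N)) (Suc d)) n =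
    fps_nth ((1 - fps_const (c (Suc N)) * fps_X) * depth_fps (elem_sym c N) (Suc d) +
     fps_const (c (Suc N)) * fps_X * depth_fps (elem_sym c N) d) n"
    by (cases n) (auto simp: depth_fps_def left_diff_distrib mult.assoc algebra_simps)
qed

text \<open>The quotient formula for the generating function with its denominator cleared. Both
  sides satisfy the same recurrence in \<open>N\<close>, by the preceding lemmas.\<close>

lemma depth_fps_mult_trunc_fps:
  "depth_fps (elem_sym c N) 0 * trunc_fps c N d = depth_fps (elem_sym c N) d"
proof (induction N arbitrary: d)
  case 0
  show ?case
  proof (cases d)
    case 0
    thus ?thesis by simp
  next
    case (Suc d')
    thus ?thesis using depth_fps_elem_sym_0_Suc[of c d'] by (simp del: elem_sym.simps)
  qed
next
  case (Suc N)
  show ?case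
  proof (cases d)
    case (Suc d')
    define P where "P = depth_fps (elem_sym c N) 0"
    define q where "q = fps_const (c (Suc N)) * fps_X"
    have "depth_fps (elem_sym c (Suc N)) 0 * trunc_fps c (Suc N) (Suc d') =
            P * ((1 - q) * trunc_fps c (Suc N) (Suc d'))"
      by (simp add: depth_fps_elem_sym_Suc_0 P_def q_def mult_ac)
    also have "\<dots> = (1 - q) * (P * trunc_fps c N (Suc d')) + q * (P * trunc_fps c N d')"
      unfolding q_def by (subst trunc_fps_Suc_Suc) (simp add: algebra_simps)
    also have "\<dots> = depth_fps (elem_sym c (Suc N)) (Suc d')"
      by (simp add: P_def q_def Suc.IH depth_fps_elem_sym_Suc_Suc)
    finally show ?thesis by (simp only: Suc)
  qed simp
qed

section \<open>The cosine product and the limits of the elementary symmetric polynomials\<close>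

lemma cos_product_formula:
  fixes x :: real
  assumes "\<bar>x\<bar> < 1"
  shows "(\<lambda>N. \<Prod>k=1..N. 1 - x\<^sup>2 / (2 * real k - 1)\<^sup>2) \<longlonglongrightarrow> cos (pi / 2 * x)"
proof (cases "x = 0")
  case False
  \<comment> \<open>Divide the product for $\sin(\pi x)$, taken up to $2N$, by the one for $\sin(\pi x/2)$:
     the even factors cancel.\<close>
  define P where "P y N = (\<Prod>k=1..N. 1 - y\<^sup>2 / (real k)\<^sup>2)" for y :: real and N
  define Q where "Q N = (\<Prod>k=1..N. 1 - x\<^sup>2 / (2 * real k - 1)\<^sup>2)" for N
  have lim: "P y \<longlonglongrightarrow> sin (pi * y) / (pi * y)" if "y \<noteq> 0" for y
    using sin_product_formula_real'[OF that] by (simp add: P_def [abs_def])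
  have split: "P x (2 * N) = Q N * P (x / 2) N" for N
  proof (induction N)
    case (Suc N)
    \<comment> \<open>The new indices are 2N+1 and 2N+2; the factor of the even one equals 1 -
      (x/2)^2/(N+1)^2.\<close>
    have "P x (2 * Suc N) =
            P x (2 * N) * ((1 - x\<^sup>2 / (2 * real (Suc N) - 1)\<^sup>2) * (1 - (x / 2)\<^sup>2 / (real (Suc N))\<^sup>2))"
      by (simp add: P_def power_divide power_mult_distrib divide_simps) (simp add: algebra_simps power2_eq_square)
    also have "P x (2 * N) = Q N * P (x / 2) N" by (fact Suc)
    finally show ?case
      unfolding P_def Q_def by (simp only: prod.nat_ivl_Suc' mult_ac le_add1 One_nat_def Suc_le_mono zero_le)
  qed (simp_all add: P_def Q_def)
  \<comment> \<open>The division is legitimate because |x| < 1 keeps every factor of the denominator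
    positive.\<close>
  have nz: "P (x / 2) N \<noteq> 0" for N
  proof -
    have "(x / 2)\<^sup>2 / (real k)\<^sup>2 < 1" if "k \<ge> 1" for k :: nat
    proof -
      have "\<bar>x / 2\<bar> < real k" using assms that by auto
      hence "(x / 2)\<^sup>2 < (real k)\<^sup>2" by (metis abs_of_nat abs_le_square_iff not_le)
      thus ?thesis using that by simp
    qed
    thus ?thesis by (force simp: P_def)
  qed
  have sin_nz: "sin (pi * (x / 2)) \<noteq> 0"
  proof
    assume "sin (pi * (x / 2)) = 0"
    then obtain i :: int where "pi * (x / 2) = of_int i * pi"
      by (auto simp: sin_zero_iff_int2)
    hence "x = 2 * of_int i" by (simp add: field_simps)
    with assms False show False by auto
  qed
  have "(\<lambda>N. P x (2 * N)) \<longlonglongrightarrow> sin (pi * x) / (pi * x)"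
    using lim[OF False] by (rule filterlim_compose) (auto intro: mult_nat_left_at_top)
  hence "(\<lambda>N. P x (2 * N) / P (x / 2) N)
           \<longlonglongrightarrow> (sin (pi * x) / (pi * x)) / (sin (pi * (x / 2)) / (pi * (x / 2)))"
    by (intro tendsto_divide lim) (use False sin_nz in auto)
  also have "(\<lambda>N. P x (2 * N) / P (x / 2) N) = Q"
    by (simp add: split nz)
  also have "sin (pi * x) = 2 * sin (pi * (x / 2)) * cos (pi * (x / 2))"
    using sin_double[of "pi * (x / 2)"] by simp
  finally show ?thesis using False sin_nz by (simp add: Q_def [abs_def] mult.commute)
qed auto

definition odd_inv_sq :: "nat \<Rightarrow> real" where
  "odd_inv_sq k = 1 / (2 * real k - 1)\<^sup>2"

lemma odd_inv_sq_nonneg: "odd_inv_sq k \<ge> 0"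
  by (simp add: odd_inv_sq_def)

lemma sum_odd_inv_sq_le: "(\<Sum>k=1..N. odd_inv_sq k) \<le> 2"
proof -
  \<comment> \<open>Strengthened for induction: 1/(2k-1)^2 is at most 1/(k-1) - 1/k for k \<ge> 2,
    which telescopes.\<close>
  have "(\<Sum>k=1..Suc N. odd_inv_sq k) \<le> 2 - 1 / real (Suc N)" for N
  proof (induction N)
    case (Suc N)
    have "odd_inv_sq (Suc (Suc N)) \<le> 1 / real (Suc N) - 1 / real (Suc (Suc N))"
      by (simp add: odd_inv_sq_def divide_simps power2_eq_square) (simp add: algebra_simps)
    with Suc show ?case by simp
  qed (simp add: odd_inv_sq_def)
  hence bound: "(\<Sum>k=1..Suc N. odd_inv_sq k) \<le> 2" for N
    by (rule order_trans) simp
  show ?thesis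
  proof (cases N)
    case (Suc M)
    show ?thesis unfolding Suc by (rule bound)
  qed simp
qed

lemma elem_sym_odd_inv_sq_le: "elem_sym odd_inv_sq N m \<le> 2 ^ m"
  by (rule order_trans[OF elem_sym_le_power[OF odd_inv_sq_nonneg]])
     (intro power_mono sum_odd_inv_sq_le sum_nonneg odd_inv_sq_nonneg)

text \<open>Once the coefficients below \<open>n\<close> agree, the difference of the two series can
  be divided by x^n; letting x tend to 0 isolates the n-th coefficient.\<close>

lemma powser_sums_unique:
  fixes a b :: "nat \<Rightarrow> 'a :: {real_normed_field, banach}"
  assumes r: "r > 0"
    and a: "\<And>x. norm x < r \<Longrightarrow> (\<lambda>n. a n * x ^ n) sums f x"
    and b: "\<And>x. norm x < r \<Longrightarrow> (\<lambda>n. b n * x ^ n) sums f x"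
  shows "a n = b n"
proof (induction n rule: less_induct)
  case (less n)
  have "((\<lambda>_. 0) \<longlongrightarrow> a (0 + n) - b (0 + n)) (at (0 :: 'a))"
  proof (rule powser_limit_0_strong[OF r])
    fix x :: 'a assume x: "x \<noteq> 0" "norm x < r"
    have "(\<lambda>k. (a k - b k) * x ^ k) sums 0"
      using sums_diff[OF a b, of x x] x by (simp add: left_diff_distrib)
    hence "(\<lambda>k. (a (k + n) - b (k + n)) * x ^ (k + n)) sums 0"
      using less by (subst sums_iff_shift) simp
    hence "(\<lambda>k. (a (k + n) - b (k + n)) * x ^ (k + n) / x ^ n) sums (0 / x ^ n)"
      by (rule sums_divide)
    thus "(\<lambda>k. (a (k + n) - b (k + n)) * x ^ k) sums 0"
      using x by (simp add: power_add)
  qed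
  from LIM_unique[OF tendsto_const this] show ?case by simp
qed

text \<open>The limits exist by monotonicity and boundedness. Exchanging limit and series shows that
  they are, up to sign, the even Taylor coefficients of cos(pi x/2).\<close>

lemma tendsto_elem_sym_odd_inv_sq:
  "(\<lambda>N. elem_sym odd_inv_sq N m) \<longlonglongrightarrow> (pi / 2) ^ (2 * m) / fact (2 * m)"
proof -
  have "\<exists>l. (\<lambda>N. elem_sym odd_inv_sq N m) \<longlonglongrightarrow> l" for m
  proof -
    have "incseq (\<lambda>N. elem_sym odd_inv_sq N m)"
      by (rule incseq_SucI)
         (auto split: nat.splits intro!: mult_nonneg_nonneg odd_inv_sq_nonneg elem_sym_nonneg)
    thus ?thesis
      using elem_sym_odd_inv_sq_le[of _ m] by (metis incseq_convergent)
  qed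
  then obtain e where e: "\<And>m. (\<lambda>N. elem_sym odd_inv_sq N m) \<longlonglongrightarrow> e m" by metis
  define G where "G = Abs_fps (\<lambda>n. if even n then (-1) ^ (n div 2) * e (n div 2) else 0)"
  have "fps_nth G n = fps_nth (fps_cos (pi / 2)) n" for n
  proof (rule powser_sums_unique)
    \<comment> \<open>The bound 2^m on the m-th elementary symmetric polynomial requires 2 x^2 < 1,
      which |x| < 1/2 ensures.\<close>
    show "1 / 2 > (0 :: real)" by simp
    show "(\<lambda>n. fps_nth (fps_cos (pi / 2)) n * x ^ n) sums cos (pi / 2 * x)" for x
    proof -
      have "fps_nth (fps_cos (pi / 2)) n * x ^ n = cos_coeff n *\<^sub>R (pi / 2 * x) ^ n" for n
        by (simp add: fps_cos_def cos_coeff_def flip: power_mult_distrib)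
      with cos_converges[of "pi / 2 * x"] show ?thesis by simp
    qed
    fix x :: real assume "norm x < 1 / 2"
    hence x: "\<bar>x\<bar> < 1 / 2" by simp
    have "\<bar>x\<bar> ^ 2 < (1 / 2) ^ 2" using x by (intro power_strict_mono) auto
    hence x2: "2 * x\<^sup>2 < 1" by (simp add: power2_eq_square)
    let ?a = "\<lambda>m N. elem_sym odd_inv_sq N m * (- (x\<^sup>2)) ^ m"
    \<comment> \<open>Limit in \<open>N\<close> and sum over \<open>m\<close> are exchanged with the
      dominating geometric series (2 x^2)^m.\<close>
    have "eventually (\<lambda>N. summable (\<lambda>m. norm (?a m N))) sequentially \<and>
            summable (\<lambda>m. norm (e m * (- (x\<^sup>2)) ^ m)) \<and>
            (\<lambda>N. \<Sum>m. ?a m N) \<longlonglongrightarrow> (\<Sum>m. e m * (- (x\<^sup>2)) ^ m)"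
    proof (rule tannerys_theorem)
      show "(\<lambda>N. ?a m N) \<longlonglongrightarrow> e m * (- (x\<^sup>2)) ^ m" for m
        by (intro tendsto_intros e)
      show "\<forall>\<^sub>F (m, N) in at_top \<times>\<^sub>F sequentially. norm (?a m N) \<le> (2 * x\<^sup>2) ^ m"
        by (rule always_eventually)
           (auto simp: abs_mult power_abs power_mult_distrib elem_sym_nonneg odd_inv_sq_nonneg
              intro!: mult_right_mono elem_sym_odd_inv_sq_le)
      show "summable (\<lambda>m. (2 * x\<^sup>2) ^ m)"
        using x2 by (intro summable_geometric) auto
    qed auto
    hence sm: "summable (\<lambda>m. e m * (- (x\<^sup>2)) ^ m)"
      and lim: "(\<lambda>N. \<Sum>m. ?a m N) \<longlonglongrightarrow> (\<Sum>m. e m * (- (x\<^sup>2)) ^ m)"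
      using summable_norm_cancel[of "\<lambda>m. e m * (- (x\<^sup>2)) ^ m"] by simp_all
    have "(\<lambda>N. \<Sum>m. ?a m N) = (\<lambda>N. \<Prod>k=1..N. 1 - x\<^sup>2 / (2 * real k - 1)\<^sup>2)"
      using sums_elem_sym[of odd_inv_sq _ "- (x\<^sup>2)"]
      by (auto simp: sums_iff odd_inv_sq_def)
    with lim cos_product_formula[of x] x have "(\<Sum>m. e m * (- (x\<^sup>2)) ^ m) = cos (pi / 2 * x)"
      by (auto intro: LIMSEQ_unique)
    hence "(\<lambda>m. e m * (- (x\<^sup>2)) ^ m) sums cos (pi / 2 * x)"
      using sm by (simp add: sums_iff)
    also have "(\<lambda>m. e m * (- (x\<^sup>2)) ^ m) = (\<lambda>m. fps_nth G (2 * m) * x ^ (2 * m))"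
      by (simp add: G_def power_minus[of "x\<^sup>2"] mult_ac flip: power_mult)
    \<comment> \<open>The odd coefficients of \<open>G\<close> vanish, so the series in x^2 is the
      full series in x.\<close>
    also have "\<dots> sums cos (pi / 2 * x) \<longleftrightarrow> (\<lambda>n. fps_nth G n * x ^ n) sums cos (pi / 2 * x)"
      by (rule sums_mono_reindex) (auto simp: strict_mono_def G_def elim!: evenE)
    finally show "(\<lambda>n. fps_nth G n * x ^ n) sums cos (pi / 2 * x)" .
  qed
  from this[of "2 * m"]
    have "(-1) ^ m * e m = (-1) ^ m * ((pi / 2) ^ (2 * m) / fact (2 * m))"
    by (simp add: G_def fps_cos_def)
  hence "e m = (pi / 2) ^ (2 * m) / fact (2 * m)"
    by (subst (asm) mult_left_cancel) simp_all
  with e[of m] show ?thesis by simp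
qed

section \<open>Passing from truncated to infinite sums\<close>

text \<open>With constant term 1 in the divisor, the n-th coefficient of the quotient is a
  polynomial expression in coefficients of divisor and dividend and in earlier quotient
  coefficients, so convergence propagates by strong induction.\<close>

lemma tendsto_fps_nth_quotient:
  fixes P :: "nat \<Rightarrow> 'a :: real_normed_field fps"
  assumes P: "\<And>n. (\<lambda>N. fps_nth (P N) n) \<longlonglongrightarrow> fps_nth p n"
    and D: "\<And>n. (\<lambda>N. fps_nth (D N) n) \<longlonglongrightarrow> fps_nth q n"
    and eq: "\<And>N. P N * R N = D N" "p * r = q"
    and one: "\<And>N. fps_nth (P N) 0 = 1" "fps_nth p 0 = 1"
  shows "(\<lambda>N. fps_nth (R N) n) \<longlonglongrightarrow> fps_nth r n"
proof (induction n rule: less_induct)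
  case (less n)
  have nth: "fps_nth b n = fps_nth (a * b) n - (\<Sum>i=1..n. fps_nth a i * fps_nth b (n - i))"
    if "fps_nth a 0 = 1" for a b :: "'a fps"
    using that by (simp add: fps_mult_nth sum.atLeast_Suc_atMost)
  have "(\<lambda>N. fps_nth (D N) n - (\<Sum>i=1..n. fps_nth (P N) i * fps_nth (R N) (n - i)))
          \<longlonglongrightarrow> fps_nth q n - (\<Sum>i=1..n. fps_nth p i * fps_nth r (n - i))"
    by (intro tendsto_intros P D less) auto
  thus ?case
    using nth[OF one(2), of r] nth[OF one(1), of "R N" N for N] by (simp add: eq)
qed

lemma nonneg_exhaustion_infsum:
  fixes f :: "'a \<Rightarrow> real"
  assumes fin: "\<And>N. finite (A N)" and mono: "incseq A" and S: "(\<Union>N. A N) = S"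
    and nonneg: "\<And>x. x \<in> S \<Longrightarrow> f x \<ge> 0" and bdd: "\<And>N. sum f (A N) \<le> B"
  shows "(\<lambda>N. sum f (A N)) \<longlonglongrightarrow> infsum f S"
proof -
  \<comment> \<open>Every finite subset of \<open>S\<close> is eventually swallowed by the
    exhaustion; this gives both the bound for summability and convergence along finite
    subsets.\<close>
  have sub: "\<exists>N. \<forall>M\<ge>N. F \<subseteq> A M" if "finite F" "F \<subseteq> S" for F
    using that
  proof (induction F rule: finite_induct)
    case (insert x F)
    then obtain N where N: "\<forall>M\<ge>N. F \<subseteq> A M" by auto
    from insert.prems S obtain K where "x \<in> A K" by auto
    with mono have "x \<in> A M" if "M \<ge> K" for M using that by (auto simp: incseq_def)
    with N show ?case by (intro exI[of _ "max N K"]) auto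
  qed auto
  have "f summable_on S"
  proof (rule nonneg_bdd_above_summable_on)
    show "bdd_above (sum f ` {F. F \<subseteq> S \<and> finite F})"
    proof (rule bdd_aboveI2)
      fix F assume "F \<in> {F. F \<subseteq> S \<and> finite F}"
      with sub[of F] obtain N where "F \<subseteq> A N" by auto
      hence "sum f F \<le> sum f (A N)" using fin by (intro sum_mono2 nonneg) (auto simp: S [symmetric])
      with bdd show "sum f F \<le> B" by (rule order_trans[rotated])
    qed
  qed (use nonneg in auto)
  hence "(sum f \<longlongrightarrow> infsum f S) (finite_subsets_at_top S)"
    by (metis has_sum_def has_sum_infsum)
  moreover have "filterlim A (finite_subsets_at_top S) sequentially"
    using sub fin unfolding filterlim_finite_subsets_at_top eventually_sequentially
    by (metis S UN_upper UNIV_I)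
  ultimately show ?thesis by (rule filterlim_compose)
qed

lemma tendsto_trunc_mtv:
  assumes "\<And>N. trunc_mtv odd_inv_sq N js \<le> B"
  shows "(\<lambda>N. trunc_mtv odd_inv_sq N js) \<longlonglongrightarrow> mtv (map (\<lambda>j. 2 * j) js)"
proof -
  define S where
    "S = {ns :: nat list. length ns = length js \<and> sorted_wrt (>) ns \<and> (\<forall>m\<in>set ns. m \<ge> 1)}"
  define f where "f ns = (\<Prod>i<length js. odd_inv_sq (ns ! i) ^ (js ! i))" for ns
  have "(\<lambda>N. sum f (decr_lists N (length js))) \<longlonglongrightarrow> infsum f S"
  proof (rule nonneg_exhaustion_infsum)
    show "incseq (\<lambda>N. decr_lists N (length js))"
      by (force simp: incseq_def decr_lists_def)
    show "(\<Union>N. decr_lists N (length js)) = S"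
    proof (intro equalityI subsetI)
      fix ns assume "ns \<in> S"
      \<comment> \<open>The largest entry serves as cutoff; inserting 0 covers the empty
        list.\<close>
      hence "ns \<in> decr_lists (Max (insert 0 (set ns))) (length js)"
        by (auto simp: S_def decr_lists_def)
      thus "ns \<in> (\<Union>N. decr_lists N (length js))" by blast
    qed (auto simp: S_def decr_lists_def)
    show "sum f (decr_lists N (length js)) \<le> B" for N
      using assms[of N] by (simp add: trunc_mtv_def f_def)
  qed (auto simp: f_def intro!: prod_nonneg zero_le_power odd_inv_sq_nonneg)
  also have "infsum f S = mtv (map (\<lambda>j. 2 * j) js)"
    unfolding mtv_def length_map S_def [symmetric]
    by (intro infsum_cong)
       (auto simp: f_def odd_inv_sq_def power_divide power_mult intro!: prod.cong)
  finally show ?thesis by (simp add: trunc_mtv_def f_def)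
qed

lemma mtv_sum_eq_compositions:
  "mtv_sum (2 * n) d = (\<Sum>js\<in>compositions d n. mtv (map (\<lambda>j. 2 * j) js))"
  by (simp add: mtv_sum_def compositions_def)

text \<open>All truncated values are nonnegative, so a bound for their convergent total bounds each
  one. This supplies the hypothesis of \<open>tendsto_trunc_mtv\<close>.\<close>

lemma mtv_sum_eq_limit:
  assumes "(\<lambda>N. fps_nth (trunc_fps odd_inv_sq N d) n) \<longlonglongrightarrow> L"
  shows "mtv_sum (2 * n) d = L"
proof -
  have nonneg: "trunc_mtv odd_inv_sq N js \<ge> 0" for N js
    unfolding trunc_mtv_def by (intro sum_nonneg prod_nonneg zero_le_power odd_inv_sq_nonneg)
  have "convergent (\<lambda>N. fps_nth (trunc_fps odd_inv_sq N d) n)"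
    using assms by (auto simp: convergent_def)
  hence "Bseq (\<lambda>N. fps_nth (trunc_fps odd_inv_sq N d) n)"
    by (rule convergent_imp_Bseq)
  then obtain B where B: "\<And>N. norm (fps_nth (trunc_fps odd_inv_sq N d) n) \<le> B"
    by (auto simp: Bseq_def)
  have "trunc_mtv odd_inv_sq N js \<le> B" if "js \<in> compositions d n" for N js
  proof -
    have "trunc_mtv odd_inv_sq N js \<le> (\<Sum>js\<in>compositions d n. trunc_mtv odd_inv_sq N js)"
      using that nonneg by (intro member_le_sum) auto
    also have "\<dots> \<le> B" using B[of N] by (simp add: trunc_fps_def)
    finally show ?thesis .
  qed
  hence "(\<lambda>N. \<Sum>js\<in>compositions d n. trunc_mtv odd_inv_sq N js) \<longlonglongrightarrow> mtv_sum (2 * n) d"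
    unfolding mtv_sum_eq_compositions by (intro tendsto_sum tendsto_trunc_mtv) auto
  with assms show ?thesis by (simp add: trunc_fps_def LIMSEQ_unique)
qed

section \<open>The secant series and comparison of coefficients\<close>

lemma sum_evens:
  fixes f :: "nat \<Rightarrow> 'a :: comm_monoid_add"
  assumes "\<And>i. odd i \<Longrightarrow> f i = 0"
  shows "(\<Sum>i=0..2 * n. f i) = (\<Sum>i=0..n. f (2 * i))"
proof (induction n)
  case (Suc n)
  thus ?case using assms[of "Suc (2 * n)"] by simp
qed simp

text \<open>The expansion of $\sec(\pi\sqrt z/2)$ in powers of $z$.\<close>
definition sec_sqrt_fps :: "real fps" where
  "sec_sqrt_fps = Abs_fps (\<lambda>l. (-1) ^ l * euler_number (2 * l) / fact (2 * l) * (pi / 2) ^ (2 * l))"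

text \<open>The \<open>depth_fps\<close> factor is the series of cos(pi sqrt(z)/2). Its n-th product
  coefficient is (pi/2)^(2n) times the coefficient of x^(2n) in cos x sec x = 1.\<close>

lemma sec_sqrt_fps_mult:
  "depth_fps (\<lambda>m. (pi / 2) ^ (2 * m) / fact (2 * m)) 0 * sec_sqrt_fps = 1"
proof (rule fps_ext)
  fix n
  define F where "F = inverse (fps_cos (1::real))"
  have sec: "fps_nth sec_sqrt_fps l = fps_nth F (2 * l) * (pi / 2) ^ (2 * l)" for l
    by (simp add: sec_sqrt_fps_def euler_number_def F_def flip: power_mult_distrib)
  have "fps_nth (depth_fps (\<lambda>m. (pi / 2) ^ (2 * m) / fact (2 * m)) 0 * sec_sqrt_fps) n =
          (\<Sum>i=0..n. (pi / 2) ^ (2 * n) * (fps_nth (fps_cos 1) (2 * i) * fps_nth F (2 * n - 2 * i)))"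
    unfolding fps_mult_nth
  proof (rule sum.cong)
    fix i assume "i \<in> {0..n}"
    hence "2 * n = 2 * i + 2 * (n - i)" by auto
    hence "(pi / 2) ^ (2 * n) = (pi / 2) ^ (2 * i) * (pi / 2) ^ (2 * (n - i))"
      by (metis power_add)
    thus "fps_nth (depth_fps (\<lambda>m. (pi / 2) ^ (2 * m) / fact (2 * m)) 0) i * fps_nth sec_sqrt_fps (n - i) =
      (pi / 2) ^ (2 * n) * (fps_nth (fps_cos 1) (2 * i) * fps_nth F (2 * n - 2 * i))"
      by (simp add: depth_fps_def sec fps_cos_def diff_mult_distrib2)
  qed simp
  also have "\<dots> = (pi / 2) ^ (2 * n) * fps_nth (fps_cos 1 * F) (2 * n)"
    unfolding fps_mult_nth by (subst sum_evens) (simp_all add: fps_cos_def sum_distrib_left)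
  also have "fps_cos 1 * F = 1"
    unfolding F_def by (rule inverse_mult_eq_1') simp
  finally show "fps_nth (depth_fps (\<lambda>m. (pi / 2) ^ (2 * m) / fact (2 * m)) 0 * sec_sqrt_fps) n =
      fps_nth 1 n" by auto
qed

theorem theorem1p3:
  fixes n d :: nat
  assumes "1 \<le> d" and "d \<le> n"
  shows "mtv_sum (2 * n) d =
           (-1) ^ (n - d) * pi ^ (2 * n) / (4 ^ n * fact (2 * n)) *
           (\<Sum>l=0..n - d. real ((n - l) choose d) * real ((2 * n) choose (2 * l)) * euler_number (2 * l))"
proof -
  define e where "e m = (pi / 2) ^ (2 * m) / fact (2 * m)" for m :: nat
  define K where "K = (-1) ^ (n - d) * pi ^ (2 * n) / (4 ^ n * fact (2 * n))"
  have lim: "(\<lambda>N. fps_nth (depth_fps (elem_sym odd_inv_sq N) d) n) \<longlonglongrightarrow> fps_nth (depth_fps e d) n"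
    for d n
    unfolding depth_fps_def fps_nth_Abs_fps e_def
    by (intro tendsto_intros tendsto_elem_sym_odd_inv_sq)
  \<comment> \<open>Multiplication by the secant series replaces division by the cosine, identifying
    the limit of the quotients.\<close>
  have "depth_fps e 0 * (sec_sqrt_fps * depth_fps e d) = depth_fps e d"
    using sec_sqrt_fps_mult by (simp add: e_def [abs_def] mult.assoc [symmetric])
  hence "(\<lambda>N. fps_nth (trunc_fps odd_inv_sq N d) n) \<longlonglongrightarrow> fps_nth (sec_sqrt_fps * depth_fps e d) n"
    by (intro tendsto_fps_nth_quotient[OF lim lim depth_fps_mult_trunc_fps])
       (auto simp: depth_fps_def e_def)
  hence "mtv_sum (2 * n) d = (\<Sum>l=0..n. fps_nth sec_sqrt_fps l * fps_nth (depth_fps e d) (n - l))"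
    by (simp add: mtv_sum_eq_limit fps_mult_nth)
  \<comment> \<open>For l > n - d the binomial coefficient (n - l) choose d is zero.\<close>
  also have "\<dots> = (\<Sum>l=0..n - d. fps_nth sec_sqrt_fps l * fps_nth (depth_fps e d) (n - l))"
    by (rule sum.mono_neutral_right) (auto simp: depth_fps_def binomial_eq_0)
  also have "\<dots> = (\<Sum>l=0..n - d. K * (real ((n - l) choose d) * real ((2 * n) choose (2 * l)) *
                     euler_number (2 * l)))"
  proof (rule sum.cong)
    fix l assume "l \<in> {0..n - d}"
    with \<open>d \<le> n\<close> have l: "l \<le> n" "d \<le> n - l" by auto
    have "(pi / 2) ^ (2 * l) * (pi / 2) ^ (2 * (n - l)) = (pi / 2) ^ (2 * n)"
      using l by (simp flip: power_add add: diff_mult_distrib2)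
    also have "\<dots> = pi ^ (2 * n) / 4 ^ n"
      by (simp add: power_divide power_mult)
    finally have pow:
      "(pi / 2) ^ (2 * l) * (pi / 2) ^ (2 * (n - l)) = pi ^ (2 * n) / 4 ^ n" .
    \<comment> \<open>The signs from the secant series and from \<open>depth_fps\<close> combine to
      one independent of \<open>l\<close>, since n + d and n - d have equal parity.\<close>
    have "l + (n - l + d) = (n - d) + 2 * d" using l by auto
    hence "(-1) ^ l * (-1) ^ (n - l + d) = ((-1) ^ (n - d) * (-1) ^ (2 * d) :: real)"
      by (metis power_add)
    hence sgn: "(-1) ^ l * (-1) ^ (n - l + d) = ((-1) ^ (n - d) :: real)"
      by simp
    have bin: "real ((2 * n) choose (2 * l)) = fact (2 * n) / (fact (2 * l) * fact (2 * (n - l)))"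
      using l by (simp add: binomial_fact diff_mult_distrib2)
    have "fps_nth sec_sqrt_fps l * fps_nth (depth_fps e d) (n - l) =
            ((-1) ^ l * (-1) ^ (n - l + d)) * ((pi / 2) ^ (2 * l) * (pi / 2) ^ (2 * (n - l))) *
            real ((n - l) choose d) * euler_number (2 * l) / (fact (2 * l) * fact (2 * (n - l)))"
      by (simp add: sec_sqrt_fps_def depth_fps_def e_def)
    also have "\<dots> = K * (real ((n - l) choose d) * real ((2 * n) choose (2 * l)) * euler_number (2 * l))"
      unfolding sgn pow bin K_def by (simp add: field_simps)
    finally show "fps_nth sec_sqrt_fps l * fps_nth (depth_fps e d) (n - l) = \<dots>" .
  qed simp
  finally show ?thesis by (simp add: K_def sum_distrib_left)
qed

end
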